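(* Let $p$ be an integer with $p\ge 1$, or $p=\infty$. Let $f:[0,\infty]\to[0,\infty)$ be a sub-diagonal and sub-additive function which is strictly increasing and $p$-increasing. Let $X$ be a normed space with topology $\tau_X$ induced by its norm, let $\tau$ denote the topology induced by the $p$-Wasserstein distance $d_p$ (the bottleneck distance if $p=\infty$) on $\mathcal{D}$ and on $\mathcal{D}_F$, and let $g:(\mathcal{D}_F,\tau)\to(X,\tau_X)$ be a continuous map. Let $\tau_*$ be the first topology of $\mathcal{D}$, defined by the divergence $D_p^f$. Let $\pi=\pi_F\circ\pi'$, where $\pi':(\mathcal{D},\tau_* )\to(\mathcal{D},\tau)$ is the identity at the set level and $\pi_F:(\mathcal{D},\tau)\to(\mathcal{D}_F,\tau)$ is the projection onto $\mathcal{D}_F$. Then the map $\tilde g:(\mathcal{D},\tau_* )\to(X,\tau_X)$ given by $\tilde g=g\circ\pi$ is continuous.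
   Context: Write $\overline{\mathbb{R}}=\mathbb{R}\cup\{+\infty\}$. A persistence diagram is the union of a finite multiset of points $(x,y)\in\overline{\mathbb{R}}^2$ with $x<y$, together with all points $(x,x)\in\overline{\mathbb{R}}^2$ (the diagonal), each taken with infinite multiplicity. $\mathcal{D}$ is the set of all persistence diagrams, and $\mathcal{D}_F\subset\mathcal{D}$ is the set of those all of whose points outside the diagonal have finite coordinates. Maps between diagrams (injections, bijections), sums over diagrams, and set differences are understood for multisets, i.e. elements are counted with multiplicity. For $a=(x_1,y_1)$, $b=(x_2,y_2)$ put $\|a-b\|_\infty=\max\{|x_1-x_2|,|y_1-y_2|\}$, where the absolute difference of two infinite coordinates is set to $0$ and that of a finite and an infinite coordinate is $\infty$. Wasserstein and bottleneck distances: for $1\le p<\infty$, $d_p(A,B)=\left(\inf_\gamma\sum_{a\in A}\|a-\gamma(a)\|_\infty^p\right)^{1/p}$ and $d_\infty(A,B)=\inf_\gamma\sup_{a\in A}\|a-\gamma(a)\|_\infty$, the infima being over all bijections $\gamma:A\to B$ (values in $[0,\infty]$). A function $f:[0,\infty]\to[0,\infty)$ is called sub-diagonal and sub-additive if it is continuous, $f(x)\le x$ for all $x\in[0,\infty]$, and $f(x+y)\le f(x)+f(y)$ for all $x,y\ge0$. It is called $p$-increasing if for every $n\in\mathbb{N}$ and $x=(x_i)\in\mathbb{R}_+^n$ one has $f(\|x\|_p)\le\|(f(x_i))_i\|_p$. Let $\lambda(x,y)=\left(\frac{x+y}{2},\frac{x+y}{2}\right)$ be the projection onto the diagonal. For $1\le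 p<\infty$ the $(f,p)$-Wasserstein divergence is $$D_p^f(A\|B)=\left(\inf_\gamma\left\{\sum_{a\in A}\|a-\gamma(a)\|_\infty^p+\sum_{b\in B\setminus\gamma(A)}f(\|b-\lambda(b)\|_\infty)^p\right\}\right)^{1/p},$$ the infimum being over all injections $\gamma:A\to B$; analogously, the $(f,\infty)$-bottleneck divergence is $$D_\infty^f(A\|B)=\inf_\gamma\max\left\{\sup_{a\in A}\|a-\gamma(a)\|_\infty,\ \sup_{b\in B\setminus\gamma(A)}f(\|b-\lambda(b)\|_\infty)\right\}.$$ The first topology $\tau_*$ of $\mathcal{D}$ (for given $f,p$) is the topology generated by the basis $\{B(A,r): A\in\mathcal{D},\ r\in\mathbb{R}^+\}$, where $B(A,r)=\{C\in\mathcal{D}: D_p^f(A\|C)<r\}$. The projection $\pi_F:\mathcal{D}\to\mathcal{D}_F$ sends $A$ to the diagram $\bar A\in\mathcal{D}_F$ minimizing $D_p^f(\,\cdot\,\|A)$ over $\mathcal{D}_F$, namely the diagram obtained from $A$ by removing all off-diagonal points with infinite coordinates. *)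

theory Defs
  imports "HOL-Analysis.Analysis"
begin

(* Points of (R \<union> {+\<infinity>})^2 are pairs of extended reals different from -\<infinity>.  A persistence diagram is
   represented by the finite multiset of its off-diagonal points; the diagonal, being common to all
   diagrams, is added back by dgm_elems below. *)

type_synonym point = "ereal \<times> ereal"

definition diagrams :: "point multiset set" where
  "diagrams = {A. \<forall>(x, y)\<in>set_mset A. x \<noteq> -\<infinity> \<and> x < y}"

definition finite_diagrams :: "point multiset set" where
  "finite_diagrams = {A \<in> diagrams. \<forall>(x, y)\<in>set_mset A. \<bar>x\<bar> \<noteq> \<infinity> \<and> \<bar>y\<bar> \<noteq> \<infinity>}"

definition diagonal :: "point set" where
  "diagonal = {(x, x) |x. x \<noteq> -\<infinity>}"

(* The elements of a diagram counted with multiplicity: (a, k) is the k-th copy of the point a.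
   Diagonal points (including (\<infinity>, \<infinity>)) have countably infinitely many copies. *)
definition dgm_elems :: "point multiset \<Rightarrow> (point \<times> nat) set" where
  "dgm_elems A = {(a, k). a \<in> diagonal \<or> k < count A a}"

(* On ereal, \<infinity> - \<infinity> = \<infinity>, hence the case distinction. *)
definition coord_dist :: "ereal \<Rightarrow> ereal \<Rightarrow> ennreal" where
  "coord_dist x y = (if x = \<infinity> \<and> y = \<infinity> then 0 else e2ennreal \<bar>x - y\<bar>)"

definition point_dist :: "point \<Rightarrow> point \<Rightarrow> ennreal" where
  "point_dist a b = max (coord_dist (fst a) (fst b)) (coord_dist (snd a) (snd b))"

definition diag_proj :: "point \<Rightarrow> point" where
  "diag_proj a = ((fst a + snd a) / 2, (fst a + snd a) / 2)"

definition ennroot :: "nat \<Rightarrow> ennreal \<Rightarrow> ennreal" where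
  "ennroot n x = (if x = top then top else ennreal (root n (enn2real x)))"

(* The exponent p is a positive integer or \<infinity>; the clauses below are not meaningful for p = 0. *)

definition wasserstein_dist :: "enat \<Rightarrow> point multiset \<Rightarrow> point multiset \<Rightarrow> ennreal" where
  "wasserstein_dist p A B =
     (case p of
        enat q \<Rightarrow> ennroot q
          (INF \<gamma>\<in>{\<gamma>. bij_betw \<gamma> (dgm_elems A) (dgm_elems B)}.
             \<Sum>\<^sub>\<infinity>a\<in>dgm_elems A. point_dist (fst a) (fst (\<gamma> a)) ^ q)
      | \<infinity> \<Rightarrow>
          (INF \<gamma>\<in>{\<gamma>. bij_betw \<gamma> (dgm_elems A) (dgm_elems B)}.
             SUP a\<in>dgm_elems A. point_dist (fst a) (fst (\<gamma> a))))"

definition dgm_injections ::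
    "point multiset \<Rightarrow> point multiset \<Rightarrow> (point \<times> nat \<Rightarrow> point \<times> nat) set" where
  "dgm_injections A B = {\<gamma>. inj_on \<gamma> (dgm_elems A) \<and> \<gamma> ` dgm_elems A \<subseteq> dgm_elems B}"

definition wasserstein_div ::
    "enat \<Rightarrow> (ennreal \<Rightarrow> ennreal) \<Rightarrow> point multiset \<Rightarrow> point multiset \<Rightarrow> ennreal" where
  "wasserstein_div p f A B =
     (case p of
        enat q \<Rightarrow> ennroot q
          (INF \<gamma>\<in>dgm_injections A B.
             (\<Sum>\<^sub>\<infinity>a\<in>dgm_elems A. point_dist (fst a) (fst (\<gamma> a)) ^ q) +
             (\<Sum>\<^sub>\<infinity>b\<in>dgm_elems B - \<gamma> ` dgm_elems A. f (point_dist (fst b) (diag_proj (fst b))) ^ q))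
      | \<infinity> \<Rightarrow>
          (INF \<gamma>\<in>dgm_injections A B.
             max (SUP a\<in>dgm_elems A. point_dist (fst a) (fst (\<gamma> a)))
                 (SUP b\<in>dgm_elems B - \<gamma> ` dgm_elems A. f (point_dist (fst b) (diag_proj (fst b))))))"

(* Functions [0,\<infinity>] \<rightarrow> [0,\<infinity>) are functions ennreal \<Rightarrow> ennreal all of whose values are finite. *)
definition subdiagonal_subadditive :: "(ennreal \<Rightarrow> ennreal) \<Rightarrow> bool" where
  "subdiagonal_subadditive f \<longleftrightarrow>
     (\<forall>x. f x < top) \<and> continuous_on UNIV f \<and> (\<forall>x. f x \<le> x) \<and> (\<forall>x y. f (x + y) \<le> f x + f y)"

definition lp_norm :: "enat \<Rightarrow> nat \<Rightarrow> (nat \<Rightarrow> ennreal) \<Rightarrow> ennreal" where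
  "lp_norm p n x =
     (case p of enat q \<Rightarrow> ennroot q (\<Sum>i<n. x i ^ q) | \<infinity> \<Rightarrow> (SUP i\<in>{..<n}. x i))"

definition p_increasing :: "enat \<Rightarrow> (ennreal \<Rightarrow> ennreal) \<Rightarrow> bool" where
  "p_increasing p f \<longleftrightarrow>
     (\<forall>n. \<forall>x :: nat \<Rightarrow> real. (\<forall>i<n. 0 \<le> x i) \<longrightarrow>
        f (lp_norm p n (\<lambda>i. ennreal (x i))) \<le> lp_norm p n (\<lambda>i. f (ennreal (x i))))"

definition ball_topology :: "'a set \<Rightarrow> ('a \<Rightarrow> 'a \<Rightarrow> ennreal) \<Rightarrow> 'a topology" where
  "ball_topology S d =
     topology_generated_by {{C \<in> S. d A C < ennreal r} |A r. A \<in> S \<and> 0 < r}"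

definition wasserstein_topology :: "enat \<Rightarrow> point multiset set \<Rightarrow> point multiset topology" where
  "wasserstein_topology p S = ball_topology S (wasserstein_dist p)"

definition first_topology :: "enat \<Rightarrow> (ennreal \<Rightarrow> ennreal) \<Rightarrow> point multiset topology" where
  "first_topology p f = ball_topology diagrams (wasserstein_div p f)"

definition proj_finite :: "point multiset \<Rightarrow> point multiset" where
  "proj_finite A = filter_mset (\<lambda>(x, y). \<bar>x\<bar> \<noteq> \<infinity> \<and> \<bar>y\<bar> \<noteq> \<infinity>) A"

end

theory Submission
  imports Defs
begin

text \<open>
  The map in question factors as
  \<open>(\<D>, \<tau>\<^sub>*) \<rightarrow> (\<D>, \<tau>) \<rightarrow> (\<D>\<^sub>F, \<tau>) \<rightarrow> X\<close>, so it suffices that the first two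
  arrows, the identity and the removal of the points at infinity, are continuous.

  For the identity, the content is a reverse estimate: a small divergence forces a small
  distance (\<open>wasserstein_dist_less_of_div\<close>).  Suppose an injection \<open>\<gamma> : A \<rightarrow> C\<close> has total cost
  below \<open>f(c)\<close>.  Each leftover point of \<open>C\<close> is charged \<open>f\<close> of its distance to the diagonal.
  Being \<open>p\<close>-increasing, \<open>f\<close> of the \<open>p\<close>-norm of these distances is at most the \<open>p\<close>-norm of the
  charges, hence below \<open>f(c)\<close>, and monotonicity strips off \<open>f\<close>: the leftover points lie
  within \<open>c\<close> of the diagonal in \<open>p\<close>-norm (\<open>p_increasing_ell_norm_less\<close>).  The matched points cost
  less than \<open>f(c) \<le> c\<close>.  Finally \<open>\<gamma>\<close> is turned into a bijection by sending spare diagonal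
  copies of \<open>A\<close> onto the leftover points (\<open>injection_to_bijection\<close>); this is possible since each
  diagonal point has infinitely many copies and absorbs countably many new ones.  So the
  distance is below \<open>2c\<close>.

  The removal of the points at infinity does not increase the distance: a bijection of finite cost
  matches points at infinity with points at infinity, and restricts to the remaining ones
  (\<open>wasserstein_dist_proj_finite\<close>).

  To pass from balls around a given diagram to arbitrary balls, it is enough that a ball
  contains a ball around each of its members.  Minkowski's inequality would give this, but
  an elementary perturbation bound for \<open>p\<close>-norms suffices (\<open>ell_norm_perturb\<close>).
\<close>

section \<open>Extended p-norms of families\<close>

text \<open>
  The \<open>\<ell>\<^sup>p\<close>-norm of a nonnegative family over an arbitrary index set.  All costs below,
  those of bijections as well as those of injections with leftover points, are such norms, so that
  the estimates on diagrams treat finite and infinite exponents uniformly.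
\<close>

definition ell_norm :: "enat \<Rightarrow> 'a set \<Rightarrow> ('a \<Rightarrow> ennreal) \<Rightarrow> ennreal" where
  "ell_norm p S h =
     (case p of enat q \<Rightarrow> ennroot q (\<Sum>\<^sub>\<infinity>s\<in>S. h s ^ q) | \<infinity> \<Rightarrow> (SUP s\<in>S. h s))"

lemma ennroot_less_iff:
  assumes "1 \<le> q"
  shows "ennroot q x < c \<longleftrightarrow> x < c ^ q"
proof (cases "x = top")
  case True
  then show ?thesis by (simp add: ennroot_def)
next
  case False
  then obtain y where y: "x = ennreal y" "0 \<le> y" by (cases x) auto
  show ?thesis
  proof (cases c)
    case (real r)
    have "root q y < r \<longleftrightarrow> y < r ^ q"
      using real_root_less_iff[of q y "r ^ q"] assms real
      by (simp add: real_root_power_cancel)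
    then show ?thesis
      using y real assms
      by (simp add: ennroot_def ennreal_less_iff ennreal_power)
  next
    case top
    then show ?thesis using y assms by (simp add: ennroot_def power_top_ennreal)
  qed
qed

lemma exponent_cases:
  assumes "1 \<le> (p :: enat)"
  obtains q where "p = enat q" "1 \<le> q" | "p = \<infinity>"
  using assms by (cases p) (auto simp: one_enat_def)

lemma ell_norm_less_finite_exponent:
  assumes "1 \<le> q"
  shows "ell_norm (enat q) S h < c \<longleftrightarrow> (\<Sum>\<^sub>\<infinity>s\<in>S. h s ^ q) < c ^ q"
  using assms by (simp add: ell_norm_def ennroot_less_iff)

lemma infsum_ennreal_mono:
  fixes h k :: "'a \<Rightarrow> ennreal"
  assumes "\<And>s. s \<in> S \<Longrightarrow> h s \<le> k s"
  shows "infsum h S \<le> infsum k S"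
  using assms by (intro infsum_mono nonneg_summable_on_complete) auto

lemma infsum_ennreal_subset_mono:
  fixes h :: "'a \<Rightarrow> ennreal"
  assumes "T \<subseteq> S"
  shows "infsum h T \<le> infsum h S"
  using assms by (intro infsum_mono_neutral nonneg_summable_on_complete) auto

lemma infsum_ennreal_add:
  fixes h k :: "'a \<Rightarrow> ennreal"
  shows "(\<Sum>\<^sub>\<infinity>s\<in>S. h s + k s) = infsum h S + infsum k S"
  by (intro infsum_add nonneg_summable_on_complete) auto

lemma infsum_ennreal_scale_le:
  fixes h :: "'a \<Rightarrow> ennreal"
  shows "(\<Sum>\<^sub>\<infinity>s\<in>S. c * h s) \<le> c * infsum h S"
proof -
  have "(\<Sum>s\<in>F. c * h s) \<le> c * infsum h S" if "finite F" "F \<subseteq> S" for F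
  proof -
    have "(\<Sum>s\<in>F. h s) \<le> infsum h S"
      using infsum_ennreal_subset_mono[OF that(2), of h] that(1) by simp
    then show ?thesis
      by (metis sum_distrib_left mult_left_mono zero_le)
  qed
  then show ?thesis
    by (intro infsum_le_finite_sums nonneg_summable_on_complete) auto
qed

lemma infsum_Plus_ennreal:
  fixes h :: "'a + 'b \<Rightarrow> ennreal"
  shows "infsum h (S <+> T) = (\<Sum>\<^sub>\<infinity>s\<in>S. h (Inl s)) + (\<Sum>\<^sub>\<infinity>t\<in>T. h (Inr t))"
proof -
  have "infsum h (S <+> T) = infsum h (Inl ` S) + infsum h (Inr ` T)"
    unfolding Plus_def by (intro infsum_Un_disjoint nonneg_summable_on_complete) auto
  then show ?thesis
    by (simp add: infsum_reindex o_def)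
qed

lemma ell_norm_mono:
  assumes "1 \<le> p" "T \<subseteq> S" "\<And>s. s \<in> T \<Longrightarrow> h s \<le> k s"
  shows "ell_norm p T h \<le> ell_norm p S k"
proof (rule leI, rule notI)
  assume less: "ell_norm p S k < ell_norm p T h"
  from assms(1) show False
  proof (cases rule: exponent_cases)
    case (1 q)
    have "(\<Sum>\<^sub>\<infinity>s\<in>T. h s ^ q) \<le> (\<Sum>\<^sub>\<infinity>s\<in>T. k s ^ q)"
      using assms(3) by (intro infsum_ennreal_mono power_mono) auto
    also have "\<dots> \<le> (\<Sum>\<^sub>\<infinity>s\<in>S. k s ^ q)"
      by (rule infsum_ennreal_subset_mono[OF assms(2)])
    also have "\<dots> < ell_norm p T h ^ q"
      using less 1 by (simp add: ell_norm_less_finite_exponent)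
    finally show False
      using 1 ell_norm_less_finite_exponent[of q T h "ell_norm p T h"] by simp
  next
    case 2
    have "(SUP s\<in>T. h s) \<le> (SUP s\<in>S. k s)"
      using assms(2,3) by (intro SUP_mono) auto
    then show False using less 2 by (simp add: ell_norm_def)
  qed
qed

lemma ell_norm_ge_element:
  assumes "1 \<le> p" "s \<in> S"
  shows "h s \<le> ell_norm p S h"
proof (rule leI, rule notI)
  assume less: "ell_norm p S h < h s"
  from assms(1) show False
  proof (cases rule: exponent_cases)
    case (1 q)
    have "h s ^ q \<le> (\<Sum>\<^sub>\<infinity>s\<in>S. h s ^ q)"
      using infsum_ennreal_subset_mono[of "{s}" S "\<lambda>s. h s ^ q"] assms(2) by simp
    then show False using less 1 by (simp add: ell_norm_less_finite_exponent leD)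
  next
    case 2
    then show False using less assms(2) by (simp add: ell_norm_def SUP_upper leD)
  qed
qed

lemma ell_norm_reindex:
  assumes "inj_on \<phi> S"
  shows "ell_norm p (\<phi> ` S) h = ell_norm p S (h \<circ> \<phi>)"
  using assms by (cases p) (simp_all add: ell_norm_def infsum_reindex o_def image_image)

lemma ell_norm_cong:
  assumes "\<And>s. s \<in> S \<Longrightarrow> h s = k s"
  shows "ell_norm p S h = ell_norm p S k"
  using assms by (cases p) (simp_all add: ell_norm_def cong: infsum_cong)

lemma ell_norm_zero:
  assumes "1 \<le> p" "\<And>s. s \<in> S \<Longrightarrow> h s = 0"
  shows "ell_norm p S h = 0"
  using assms(1)
proof (cases rule: exponent_cases)
  case (1 q)
  have "(\<Sum>\<^sub>\<infinity>s\<in>S. h s ^ q) = 0"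
    using assms(2) 1 by (intro infsum_0) auto
  then show ?thesis using 1 by (simp add: ell_norm_def ennroot_def)
next
  case 2
  have "(SUP s\<in>S. h s) \<le> 0"
    using assms(2) by (intro SUP_least) simp
  then show ?thesis using 2 by (simp add: ell_norm_def)
qed

text \<open>Supports are what reduces a norm over the infinitely many elements of a diagram to the finite
  sequences for which being \<open>p\<close>-increasing is defined.\<close>

lemma ell_norm_support:
  assumes "1 \<le> p" "T \<subseteq> S" "\<And>s. s \<in> S - T \<Longrightarrow> h s = 0"
  shows "ell_norm p S h = ell_norm p T h"
proof (rule antisym)
  show "ell_norm p T h \<le> ell_norm p S h"
    by (rule ell_norm_mono[OF assms(1,2)]) simp
  from assms(1) show "ell_norm p S h \<le> ell_norm p T h"
  proof (cases rule: exponent_cases)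
    case (1 q)
    have "(\<Sum>\<^sub>\<infinity>s\<in>S. h s ^ q) = (\<Sum>\<^sub>\<infinity>s\<in>T. h s ^ q)"
      using assms(2,3) 1 by (intro infsum_cong_neutral) auto
    then show ?thesis using 1 by (simp add: ell_norm_def)
  next
    case 2
    have "h s \<le> (SUP s\<in>T. h s)" if "s \<in> S" for s
      using that assms(3)[of s] by (cases "s \<in> T") (auto intro: SUP_upper)
    then show ?thesis using 2 by (simp add: ell_norm_def SUP_least)
  qed
qed

lemma ell_norm_Plus_lessD:
  assumes "1 \<le> p" "ell_norm p (S <+> T) (case_sum h k) < c"
  shows "ell_norm p S h < c" "ell_norm p T k < c"
proof -
  have "ell_norm p (Inl ` S) (case_sum h k) \<le> ell_norm p (S <+> T) (case_sum h k)"
    "ell_norm p (Inr ` T) (case_sum h k) \<le> ell_norm p (S <+> T) (case_sum h k)"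
    by (auto intro!: ell_norm_mono[OF assms(1)])
  then show "ell_norm p S h < c" "ell_norm p T k < c"
    using assms(2) by (auto simp: ell_norm_reindex o_def)
qed

text \<open>
  The constant \<open>2\<close> serves all exponents at once: for finite \<open>q \<ge> 1\<close> the sharp factor is
  \<open>2\<close> to the power \<open>1/q\<close>, for the supremum it is \<open>1\<close>.
\<close>

lemma ell_norm_Plus_less:
  assumes "1 \<le> p" "ell_norm p S h < c" "ell_norm p T k < c"
  shows "ell_norm p (S <+> T) (case_sum h k) < 2 * c"
  using assms(1)
proof (cases rule: exponent_cases)
  case (1 q)
  have "infsum (\<lambda>s. case_sum h k s ^ q) (S <+> T) = (\<Sum>\<^sub>\<infinity>s\<in>S. h s ^ q) + (\<Sum>\<^sub>\<infinity>t\<in>T. k t ^ q)"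
    by (simp add: infsum_Plus_ennreal)
  also have "\<dots> < c ^ q + c ^ q"
    using assms 1 by (intro add_strict_mono) (auto simp: ell_norm_less_finite_exponent)
  also have "\<dots> = 2 ^ 1 * c ^ q"
    by (simp add: mult_2)
  also have "\<dots> \<le> 2 ^ q * c ^ q"
    using 1 by (intro mult_right_mono power_increasing) auto
  finally show ?thesis
    using 1 by (simp add: ell_norm_less_finite_exponent power_mult_distrib)
next
  case 2
  have "(SUP s\<in>S <+> T. case_sum h k s) = max (SUP s\<in>S. h s) (SUP t\<in>T. k t)"
    by (simp add: Plus_def SUP_union image_image sup_max)
  moreover have "c \<le> 2 * c"
    by (simp add: mult_2)
  ultimately show ?thesis
    using assms 2 by (auto simp: ell_norm_def intro: less_le_trans)
qed

text \<open>If \<open>y \<le> t x\<close> then \<open>x + y \<le> (1 + t) x\<close>, and otherwise \<open>x + y \<le> (1 + 1/t) y\<close>.\<close>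

lemma power_add_weighted_bound:
  fixes x y :: ennreal and t :: real
  assumes "0 < t"
  shows "(x + y) ^ q \<le> ennreal ((1 + t) ^ q) * x ^ q + ennreal ((1 + 1 / t) ^ q) * y ^ q"
proof (cases "y \<le> ennreal t * x")
  case True
  then have "x + y \<le> x + ennreal t * x"
    by (rule add_left_mono)
  also have "\<dots> = ennreal (1 + t) * x"
    using assms by (simp add: distrib_right)
  finally have "x + y \<le> ennreal (1 + t) * x" .
  then have "(x + y) ^ q \<le> (ennreal (1 + t) * x) ^ q"
    by (intro power_mono) auto
  then show ?thesis
    using assms by (simp add: power_mult_distrib ennreal_power add_increasing2 del: ennreal_plus)
next
  case False
  have "x = ennreal (1 / t) * (ennreal t * x)"
    using assms ennreal_mult[of "1 / t" t] by (simp add: mult.assoc[symmetric])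
  also have "\<dots> \<le> ennreal (1 / t) * y"
    using False by (intro mult_left_mono) auto
  finally have "x + y \<le> ennreal (1 + 1 / t) * y"
    using assms by (simp add: distrib_right)
  then have "(x + y) ^ q \<le> (ennreal (1 + 1 / t) * y) ^ q"
    by (intro power_mono) auto
  then show ?thesis
    using assms by (simp add: power_mult_distrib ennreal_power add_increasing del: ennreal_plus)
qed

text \<open>A local substitute for Minkowski's inequality.  By the weighted bound, the \<open>q\<close>-th power sum of
  \<open>d + e\<close> is at most \<open>(1 + t)\<^sup>q\<close> times that of \<open>d\<close> plus a constant times that of \<open>e\<close>.  For small \<open>t\<close> the
  first term stays below \<open>r\<^sup>q\<close>, and \<open>\<epsilon>\<close> is chosen so that the second one fills at most the gap.\<close>

lemma ell_norm_perturb: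
  assumes "1 \<le> p" "ell_norm p S d < ennreal r"
  obtains \<epsilon> where "0 < \<epsilon>"
    "\<And>e. ell_norm p S e < ennreal \<epsilon> \<Longrightarrow> ell_norm p S (\<lambda>s. d s + e s) < ennreal r"
  using assms(1)
proof (cases rule: exponent_cases)
  case (1 q)
  have r: "0 < r"
    using assms(2) by (metis ennreal_eq_0_iff not_le not_less_zero)
  define D where "D = (\<Sum>\<^sub>\<infinity>s\<in>S. d s ^ q)"
  have "D < ennreal (r ^ q)"
    using assms(2) 1 r by (simp add: D_def ell_norm_less_finite_exponent ennreal_power)
  then obtain D' where D': "D = ennreal D'" "0 \<le> D'" "D' < r ^ q"
    by (cases D) (auto simp: ennreal_less_iff)
  have "((\<lambda>t. (1 + t) ^ q * D') \<longlongrightarrow> (1 + 0) ^ q * D') (at_right 0)"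
    by (intro tendsto_intros)
  then have "\<forall>\<^sub>F t in at_right 0. (1 + t) ^ q * D' < r ^ q"
    by (rule order_tendstoD) (use D' in simp)
  then obtain t where t: "0 < t" "(1 + t) ^ q * D' < r ^ q"
    using eventually_happens'[OF trivial_limit_at_right_real
        eventually_conj[OF eventually_at_right_less[of 0]]] by blast
  define K where "K = (1 + 1 / t) ^ q"
  have K: "0 < K" using t by (simp add: K_def add_pos_pos)
  define gap where "gap = (r ^ q - (1 + t) ^ q * D') / K"
  have gap: "0 < gap" using t K by (simp add: gap_def)
  define \<epsilon> where "\<epsilon> = root q gap"
  have \<epsilon>: "0 < \<epsilon>" "\<epsilon> ^ q = gap" using gap 1 by (simp_all add: \<epsilon>_def)
  have "ell_norm p S (\<lambda>s. d s + e s) < ennreal r" if e: "ell_norm p S e < ennreal \<epsilon>" for e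
  proof -
    have "(\<Sum>\<^sub>\<infinity>s\<in>S. e s ^ q) < ennreal gap"
      using e 1 \<epsilon> by (simp add: ell_norm_less_finite_exponent ennreal_power)
    then obtain E where E: "(\<Sum>\<^sub>\<infinity>s\<in>S. e s ^ q) = ennreal E" "0 \<le> E" "E < gap"
      by (cases "\<Sum>\<^sub>\<infinity>s\<in>S. e s ^ q") (auto simp: ennreal_less_iff)
    have "(\<Sum>\<^sub>\<infinity>s\<in>S. (d s + e s) ^ q)
        \<le> (\<Sum>\<^sub>\<infinity>s\<in>S. ennreal ((1 + t) ^ q) * d s ^ q + ennreal K * e s ^ q)"
      unfolding K_def by (intro infsum_ennreal_mono power_add_weighted_bound t)
    also have "\<dots> \<le> ennreal ((1 + t) ^ q) * ennreal D' + ennreal K * ennreal E"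
      unfolding infsum_ennreal_add D'(1)[symmetric] E(1)[symmetric] D_def
      by (intro add_mono infsum_ennreal_scale_le)
    also have "\<dots> = ennreal ((1 + t) ^ q * D' + K * E)"
      using t K D' E by (simp add: ennreal_mult)
    also have "\<dots> < ennreal (r ^ q)"
    proof (rule ennreal_lessI)
      have "K * E < K * gap" using E K by simp
      then show "(1 + t) ^ q * D' + K * E < r ^ q" using K by (simp add: gap_def)
    qed (use r in simp)
    finally show ?thesis
      using 1 r by (simp add: ell_norm_less_finite_exponent ennreal_power)
  qed
  then show ?thesis using that \<epsilon>(1) by blast
next
  case 2
  then have "(SUP s\<in>S. d s) < ennreal r"
    using assms(2) by (simp add: ell_norm_def)
  then obtain D where D: "(SUP s\<in>S. d s) = ennreal D" "0 \<le> D" "D < r"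
    by (cases "SUP s\<in>S. d s") (auto simp: ennreal_less_iff)
  have "ell_norm p S (\<lambda>s. d s + e s) < ennreal r" if e: "ell_norm p S e < ennreal (r - D)" for e
  proof -
    have "(SUP s\<in>S. e s) < ennreal (r - D)" using e 2 by (simp add: ell_norm_def)
    then obtain E where E: "(SUP s\<in>S. e s) = ennreal E" "0 \<le> E" "E < r - D"
      by (cases "SUP s\<in>S. e s") (auto simp: ennreal_less_iff)
    have "(SUP s\<in>S. d s + e s) \<le> ennreal D + ennreal E"
      unfolding D(1)[symmetric] E(1)[symmetric] by (intro SUP_least add_mono SUP_upper)
    also have "\<dots> = ennreal (D + E)" using D E by simp
    also have "\<dots> < ennreal r" using D E by (intro ennreal_lessI) auto
    finally show ?thesis using 2 by (simp add: ell_norm_def)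
  qed
  then show ?thesis using that[of "r - D"] D by simp
qed

text \<open>Monotonicity lets \<open>f\<close> be cancelled once \<open>f(\<parallel>h\<parallel>\<^sub>p) \<le> \<parallel>f \<circ> h\<parallel>\<^sub>p < f(c)\<close> is known.
  The first inequality is assumed only for finite sequences of real numbers.  Finite support together with
  \<open>f(0) = 0\<close> supplies the finiteness; an infinite value of \<open>h\<close> is impossible, for it would contribute
  \<open>f(\<infinity>) \<ge> f(c)\<close> to the norm on its own.\<close>

lemma p_increasing_ell_norm_less:
  assumes "1 \<le> p" "strict_mono f" "f 0 = 0" "p_increasing p f"
    and fin: "finite {b \<in> R. h b \<noteq> 0}"
    and less: "ell_norm p R (\<lambda>b. f (h b)) < f c"
  shows "ell_norm p R h < c"
proof -
  define S where "S = {b \<in> R. h b \<noteq> 0}"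
  have h_finite: "h b < top" if "b \<in> R" for b
  proof -
    have "f (h b) < f c"
      using ell_norm_ge_element[OF assms(1) that, of "\<lambda>b. f (h b)"] less by simp
    then have "h b < c" using assms(2) by (simp add: strict_mono_less)
    then show ?thesis by (metis less_le_trans top_greatest)
  qed
  obtain e where e: "bij_betw e {..<card S} S"
    using ex_bij_betw_nat_finite[of S] fin unfolding S_def[symmetric] by (auto simp: atLeast0LessThan)
  define x where "x i = enn2real (h (e i))" for i
  have x: "ennreal (x i) = h (e i)" if "i < card S" for i
    using h_finite[of "e i"] bij_betwE[OF e] that by (auto simp: x_def S_def)
  have lp: "lp_norm p n k = ell_norm p {..<n} k" for n k
    by (cases p) (simp_all add: lp_norm_def ell_norm_def)
  have transfer: "ell_norm p {..<card S} (\<lambda>i. k (ennreal (x i))) = ell_norm p R (\<lambda>b. k (h b))"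
    if "k 0 = 0" for k :: "ennreal \<Rightarrow> ennreal"
  proof -
    have "ell_norm p {..<card S} (\<lambda>i. k (ennreal (x i))) = ell_norm p {..<card S} ((\<lambda>b. k (h b)) \<circ> e)"
      by (rule ell_norm_cong) (simp add: x)
    also have "\<dots> = ell_norm p S (\<lambda>b. k (h b))"
      using e by (simp add: ell_norm_reindex[symmetric] bij_betw_def)
    also have "\<dots> = ell_norm p R (\<lambda>b. k (h b))"
      using that by (intro ell_norm_support[symmetric] assms(1)) (auto simp: S_def)
    finally show ?thesis .
  qed
  have "f (lp_norm p (card S) (\<lambda>i. ennreal (x i))) \<le> lp_norm p (card S) (\<lambda>i. f (ennreal (x i)))"
    using assms(4) by (auto simp: p_increasing_def x_def)
  then have "f (ell_norm p R h) \<le> ell_norm p R (\<lambda>b. f (h b))"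
    using transfer[of f] transfer[of "\<lambda>y. y"] assms(3) by (simp add: lp)
  then have "f (ell_norm p R h) < f c" using less by simp
  then show ?thesis using assms(2) by (simp add: strict_mono_less)
qed

section \<open>The ground metric and the elements of a diagram\<close>

lemma coord_dist_triangle: "coord_dist x z \<le> coord_dist x y + coord_dist y z"
proof -
  have "ennreal \<bar>a - c\<bar> \<le> ennreal \<bar>a - b\<bar> + ennreal \<bar>b - c\<bar>" for a b c :: real
    unfolding ennreal_plus[symmetric, OF abs_ge_zero abs_ge_zero] by (rule ennreal_leI) simp
  then show ?thesis
    by (cases x; cases y; cases z) (simp_all add: coord_dist_def)
qed

lemma coord_dist_commute: "coord_dist x y = coord_dist y x"
  by (cases x; cases y) (auto simp: coord_dist_def abs_minus_commute)

lemma coord_dist_refl: "x \<noteq> -\<infinity> \<Longrightarrow> coord_dist x x = 0"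
  by (cases x) (auto simp: coord_dist_def e2ennreal_neg)

lemma coord_dist_finite_imp: "coord_dist x y < top \<Longrightarrow> x = \<infinity> \<longleftrightarrow> y = \<infinity>"
  by (cases x; cases y) (auto simp: coord_dist_def)

lemma point_dist_triangle: "point_dist a c \<le> point_dist a b + point_dist b c"
proof -
  have "coord_dist (fst a) (fst c) \<le> point_dist a b + point_dist b c"
    by (rule order_trans[OF coord_dist_triangle[of _ _ "fst b"]])
      (auto simp: point_dist_def intro!: add_mono)
  moreover have "coord_dist (snd a) (snd c) \<le> point_dist a b + point_dist b c"
    by (rule order_trans[OF coord_dist_triangle[of _ _ "snd b"]])
      (auto simp: point_dist_def intro!: add_mono)
  ultimately show ?thesis
    by (simp add: point_dist_def[of a c])
qed

lemma point_dist_commute: "point_dist a b = point_dist b a"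
  by (simp add: point_dist_def coord_dist_commute)

text \<open>Off the diagonal a diagram is finite; this is the finite set that contains its off-diagonal part.\<close>

lemma dgm_elem_cases:
  assumes "a \<in> dgm_elems A"
  shows "fst a \<in> diagonal \<or> a \<in> (SIGMA x:set_mset A. {..<count A x})"
  using assms by (auto simp: dgm_elems_def intro!: count_inI)

lemma dgm_elems_not_minus_infinity:
  assumes "A \<in> diagrams" "a \<in> dgm_elems A"
  shows "fst (fst a) \<noteq> -\<infinity>" "snd (fst a) \<noteq> -\<infinity>"
proof -
  obtain x y k where a: "a = ((x, y), k)" by (metis surj_pair)
  have "x \<noteq> -\<infinity> \<and> y \<noteq> -\<infinity>"
  proof (cases "(x, y) \<in> diagonal")
    case False
    then have "(x, y) \<in># A"
      using dgm_elem_cases[OF assms(2)] a by auto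
    then show ?thesis using assms(1) by (auto simp: diagrams_def)
  qed (auto simp: diagonal_def)
  then show "fst (fst a) \<noteq> -\<infinity>" "snd (fst a) \<noteq> -\<infinity>" using a by auto
qed

lemma point_dist_self:
  assumes "A \<in> diagrams" "a \<in> dgm_elems A"
  shows "point_dist (fst a) (fst a) = 0"
  using dgm_elems_not_minus_infinity[OF assms] by (simp add: point_dist_def coord_dist_refl)

lemma diag_proj_in_diagonal:
  assumes "A \<in> diagrams" "a \<in> dgm_elems A"
  shows "diag_proj (fst a) \<in> diagonal"
  using dgm_elems_not_minus_infinity[OF assms]
  by (cases "fst (fst a)"; cases "snd (fst a)") (auto simp: diag_proj_def diagonal_def)

lemma diag_proj_diagonal: "x \<in> diagonal \<Longrightarrow> diag_proj x = x"
proof -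
  have "(y + y) / 2 = y" if "y \<noteq> -\<infinity>" for y :: ereal
    using that by (cases y) auto
  then show "x \<in> diagonal \<Longrightarrow> diag_proj x = x" by (auto simp: diag_proj_def diagonal_def)
qed

lemma point_dist_diagonal: "x \<in> diagonal \<Longrightarrow> point_dist x x = 0"
  by (auto simp: diagonal_def point_dist_def coord_dist_refl)

section \<open>Distance versus divergence\<close>

lemma wasserstein_dist_less_iff:
  assumes "1 \<le> p"
  shows "wasserstein_dist p A B < c \<longleftrightarrow>
    (\<exists>\<gamma>. bij_betw \<gamma> (dgm_elems A) (dgm_elems B) \<and>
       ell_norm p (dgm_elems A) (\<lambda>a. point_dist (fst a) (fst (\<gamma> a))) < c)"
  using assms
  by (cases rule: exponent_cases)
    (auto simp: wasserstein_dist_def ell_norm_def ennroot_less_iff INF_less_iff)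

text \<open>Both contributions to the cost of an injection, from the matched and from the leftover elements, are
  collected into a single norm over a disjoint union.  Strict inequalities avoid
  commuting the \<open>q\<close>-th root with the infimum.\<close>

lemma wasserstein_div_less_iff:
  assumes "1 \<le> p"
  shows "wasserstein_div p f A B < c \<longleftrightarrow>
    (\<exists>\<gamma>\<in>dgm_injections A B.
       ell_norm p (dgm_elems A <+> (dgm_elems B - \<gamma> ` dgm_elems A))
         (case_sum (\<lambda>a. point_dist (fst a) (fst (\<gamma> a)))
                   (\<lambda>b. f (point_dist (fst b) (diag_proj (fst b))))) < c)"
  using assms
proof (cases rule: exponent_cases)
  case (1 q)
  then show ?thesis
    by (simp add: wasserstein_div_def ell_norm_def ennroot_less_iff INF_less_iff infsum_Plus_ennreal)
next
  case 2
  then show ?thesis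
    by (simp add: wasserstein_div_def ell_norm_def INF_less_iff Plus_def SUP_union image_image sup_max
        del: max_less_iff_conj)
qed

lemma bij_betw_of_fibres:
  assumes "\<And>x. \<exists>g. bij_betw g {e \<in> E. h e = x} {e \<in> E'. h' e = x}"
  obtains \<phi> where "bij_betw \<phi> E E'" "\<And>e. e \<in> E \<Longrightarrow> h' (\<phi> e) = h e"
proof -
  obtain G where G: "\<And>x. bij_betw (G x) {e \<in> E. h e = x} {e \<in> E'. h' e = x}"
    using assms by metis
  define \<phi> where "\<phi> e = G (h e) e" for e
  have mem: "\<phi> e \<in> E' \<and> h' (\<phi> e) = h e" if "e \<in> E" for e
    using bij_betwE[OF G[of "h e"]] that by (auto simp: \<phi>_def)
  have "inj_on \<phi> E"
  proof (rule inj_onI)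
    fix d e assume de: "d \<in> E" "e \<in> E" "\<phi> d = \<phi> e"
    then have "h d = h e" using mem by metis
    then show "d = e"
      using de bij_betw_imp_inj_on[OF G[of "h e"]] by (auto simp: \<phi>_def inj_on_def)
  qed
  moreover have "e' \<in> \<phi> ` E" if "e' \<in> E'" for e'
  proof -
    have "e' \<in> G (h' e') ` {e \<in> E. h e = h' e'}"
      using bij_betw_imp_surj_on[OF G[of "h' e'"]] that by auto
    then obtain e where "e \<in> E" "h e = h' e'" "e' = G (h' e') e" by blast
    then show ?thesis by (intro image_eqI[of _ _ e]) (simp_all add: \<phi>_def)
  qed
  ultimately have "bij_betw \<phi> E E'" using mem by (auto simp: bij_betw_def)
  then show ?thesis using that mem by blast
qed

lemma bij_betw_countable_infinite:
  assumes "countable S" "infinite S" "countable T" "infinite T"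
  shows "\<exists>g. bij_betw g S T"
  using bij_betw_trans[OF to_nat_on_infinite[OF assms(1,2)]
      bij_betw_inv_into[OF to_nat_on_infinite[OF assms(3,4)]]] by blast

text \<open>Let \<open>R\<close> be the set of leftover elements.  Extending \<open>\<gamma>\<close> by the identity on \<open>R\<close> gives a bijection
  from the disjoint union of \<open>A\<close> and \<open>R\<close> onto \<open>C\<close>.  Placing each element of \<open>R\<close> at its projection to the
  diagonal, \<open>A\<close> and its disjoint union with \<open>R\<close> have equinumerous fibres over every point of the plane:
  off the diagonal \<open>R\<close> contributes nothing, and on the diagonal both fibres are countably infinite.
  Hence \<open>A\<close> is in bijection with the disjoint union by a map that fixes positions, and the
  composition of the two maps moves each element exactly as far as the cost of \<open>\<gamma>\<close> (with \<open>f\<close> the identity)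
  accounts for.\<close>

lemma injection_to_bijection:
  assumes "C \<in> diagrams" and "\<gamma> \<in> dgm_injections A C"
  obtains \<gamma>' where "bij_betw \<gamma>' (dgm_elems A) (dgm_elems C)"
    "\<And>p. ell_norm p (dgm_elems A) (\<lambda>a. point_dist (fst a) (fst (\<gamma>' a))) =
      ell_norm p (dgm_elems A <+> (dgm_elems C - \<gamma> ` dgm_elems A))
         (case_sum (\<lambda>a. point_dist (fst a) (fst (\<gamma> a)))
                   (\<lambda>b. point_dist (fst b) (diag_proj (fst b))))"
proof -
  define R where "R = dgm_elems C - \<gamma> ` dgm_elems A"
  \<comment> \<open>the position of an element, leftover ones being placed at their projections\<close>
  define u :: "(point \<times> nat) + (point \<times> nat) \<Rightarrow> point"
    where "u = case_sum fst (diag_proj \<circ> fst)"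
  have "\<exists>g. bij_betw g {e \<in> dgm_elems A. fst e = x} {e \<in> dgm_elems A <+> R. u e = x}" for x
  proof (cases "x \<in> diagonal")
    case True
    have A: "{e \<in> dgm_elems A. fst e = x} = {x} \<times> UNIV"
      using True by (auto simp: dgm_elems_def)
    have inf: "infinite ({x} \<times> (UNIV :: nat set))"
      by (simp add: finite_cartesian_product_iff)
    have "Inl ` ({x} \<times> UNIV) \<subseteq> {e \<in> dgm_elems A <+> R. u e = x}"
    proof
      fix e :: "(point \<times> nat) + (point \<times> nat)"
      assume "e \<in> Inl ` ({x} \<times> UNIV)"
      then obtain k where "e = Inl (x, k)" by blast
      then show "e \<in> {e \<in> dgm_elems A <+> R. u e = x}"
        using True by (auto simp: u_def dgm_elems_def)
    qed
    moreover have "infinite (Inl ` ({x} \<times> (UNIV :: nat set)) :: ((point \<times> nat) + (point \<times> nat)) set)"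
      using inf by (subst finite_image_iff) auto
    ultimately have inf': "infinite {e \<in> dgm_elems A <+> R. u e = x}"
      using infinite_super by blast
    \<comment> \<open>an element projecting to \<open>x\<close> is a copy of \<open>x\<close> itself or one of the off-diagonal points of \<open>C\<close>\<close>
    have "e \<in> Inl ` ({x} \<times> UNIV) \<union> Inr ` (insert x (set_mset C) \<times> UNIV)"
      if "e \<in> dgm_elems A <+> R" "u e = x" for e
    proof (cases e)
      case (Inl a)
      then show ?thesis using that by (cases a) (auto simp: u_def)
    next
      case (Inr b)
      then have "b \<in> dgm_elems C" "diag_proj (fst b) = x"
        using that by (auto simp: u_def R_def)
      then have "fst b \<in> insert x (set_mset C)"
        using dgm_elem_cases[of b C] diag_proj_diagonal[of "fst b"] by auto
      then show ?thesis using Inr by (cases b) auto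
    qed
    then have "{e \<in> dgm_elems A <+> R. u e = x}
        \<subseteq> Inl ` ({x} \<times> UNIV) \<union> Inr ` (insert x (set_mset C) \<times> UNIV)" by blast
    then have "countable {e \<in> dgm_elems A <+> R. u e = x}"
      by (rule countable_subset)
        (intro countable_Un countable_image countable_SIGMA; simp add: countable_finite)
    then show ?thesis
      using bij_betw_countable_infinite[OF _ inf _ inf'] unfolding A by simp
  next
    case False
    then have "{e \<in> dgm_elems A <+> R. u e = x} = Inl ` {e \<in> dgm_elems A. fst e = x}"
      using diag_proj_in_diagonal[OF assms(1)] by (auto simp: u_def R_def)
    then show ?thesis by (intro exI[of _ Inl]) (auto simp: bij_betw_def)
  qed
  then obtain \<phi> where \<phi>: "bij_betw \<phi> (dgm_elems A) (dgm_elems A <+> R)"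
    "\<And>a. a \<in> dgm_elems A \<Longrightarrow> u (\<phi> a) = fst a"
    by (rule bij_betw_of_fibres) (rule that)
  define \<psi> where "\<psi> = case_sum \<gamma> (\<lambda>b. b)"
  have \<gamma>: "inj_on \<gamma> (dgm_elems A)" "\<gamma> ` dgm_elems A \<subseteq> dgm_elems C"
    using assms(2) by (simp_all add: dgm_injections_def)
  have "inj_on \<psi> (dgm_elems A <+> R)"
  proof (rule inj_onI)
    fix s t assume "s \<in> dgm_elems A <+> R" "t \<in> dgm_elems A <+> R" "\<psi> s = \<psi> t"
    then show "s = t"
      using inj_onD[OF \<gamma>(1)] by (cases s; cases t) (simp_all add: \<psi>_def R_def, blast+)
  qed
  moreover have "\<psi> ` (dgm_elems A <+> R) = dgm_elems C"
  proof -
    have "\<psi> ` (dgm_elems A <+> R) = \<gamma> ` dgm_elems A \<union> R"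
      by (simp add: Plus_def image_Un image_image \<psi>_def)
    then show ?thesis using \<gamma>(2) by (simp add: R_def Un_absorb1)
  qed
  ultimately have \<psi>: "bij_betw \<psi> (dgm_elems A <+> R) (dgm_elems C)"
    by (simp add: bij_betw_def)
  have dist: "point_dist (fst a) (fst (\<psi> (\<phi> a))) =
      case_sum (\<lambda>a. point_dist (fst a) (fst (\<gamma> a)))
        (\<lambda>b. point_dist (fst b) (diag_proj (fst b))) (\<phi> a)" if "a \<in> dgm_elems A" for a
    using \<phi>(2)[OF that] by (cases "\<phi> a") (auto simp: u_def \<psi>_def point_dist_commute)
  show ?thesis
  proof (rule that[of "\<psi> \<circ> \<phi>"])
    show "bij_betw (\<psi> \<circ> \<phi>) (dgm_elems A) (dgm_elems C)"
      by (rule bij_betw_trans[OF \<phi>(1) \<psi>])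
    show "ell_norm p (dgm_elems A) (\<lambda>a. point_dist (fst a) (fst ((\<psi> \<circ> \<phi>) a))) =
      ell_norm p (dgm_elems A <+> (dgm_elems C - \<gamma> ` dgm_elems A))
         (case_sum (\<lambda>a. point_dist (fst a) (fst (\<gamma> a)))
                   (\<lambda>b. point_dist (fst b) (diag_proj (fst b))))" for p
      unfolding R_def[symmetric] bij_betw_imp_surj_on[OF \<phi>(1), symmetric]
        ell_norm_reindex[OF bij_betw_imp_inj_on[OF \<phi>(1)]]
      by (rule ell_norm_cong) (simp add: dist)
  qed
qed

text \<open>The matched part costs less than \<open>f(c) \<le> c\<close> and the leftover part lies within \<open>c\<close> of the diagonal, whence
  the factor \<open>2\<close>.  For finite \<open>c\<close> the hypothesis already excludes leftover points at
  infinity, since those are charged \<open>f(\<infinity>) > f(c)\<close>.\<close>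

lemma wasserstein_dist_less_of_div:
  assumes "1 \<le> p" "subdiagonal_subadditive f" "strict_mono f" "p_increasing p f"
    and "C \<in> diagrams" "wasserstein_div p f A C < f c"
  shows "wasserstein_dist p A C < 2 * c"
proof -
  have f: "f c \<le> c" "f 0 = 0"
    using assms(2) by (auto simp: subdiagonal_subadditive_def simp flip: le_zero_eq)
  obtain \<gamma> where \<gamma>: "\<gamma> \<in> dgm_injections A C"
    and less: "ell_norm p (dgm_elems A <+> (dgm_elems C - \<gamma> ` dgm_elems A))
         (case_sum (\<lambda>a. point_dist (fst a) (fst (\<gamma> a)))
                   (\<lambda>b. f (point_dist (fst b) (diag_proj (fst b))))) < f c"
    using assms(6) wasserstein_div_less_iff[OF assms(1)] by blast
  note parts = ell_norm_Plus_lessD[OF assms(1) less]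
  have "finite {b \<in> dgm_elems C - \<gamma> ` dgm_elems A. point_dist (fst b) (diag_proj (fst b)) \<noteq> 0}"
    by (rule finite_subset[of _ "SIGMA x:set_mset C. {..<count C x}"])
      (use dgm_elem_cases in \<open>fastforce simp: diag_proj_diagonal point_dist_diagonal\<close>, simp)
  then have "ell_norm p (dgm_elems C - \<gamma> ` dgm_elems A)
      (\<lambda>b. point_dist (fst b) (diag_proj (fst b))) < c"
    by (rule p_increasing_ell_norm_less[OF assms(1,3) f(2) assms(4) _ parts(2)])
  with parts(1) f(1) have "ell_norm p (dgm_elems A <+> (dgm_elems C - \<gamma> ` dgm_elems A))
         (case_sum (\<lambda>a. point_dist (fst a) (fst (\<gamma> a)))
                   (\<lambda>b. point_dist (fst b) (diag_proj (fst b)))) < 2 * c"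
    by (intro ell_norm_Plus_less assms(1)) auto
  moreover obtain \<gamma>' where "bij_betw \<gamma>' (dgm_elems A) (dgm_elems C)"
    "\<And>p. ell_norm p (dgm_elems A) (\<lambda>a. point_dist (fst a) (fst (\<gamma>' a))) =
      ell_norm p (dgm_elems A <+> (dgm_elems C - \<gamma> ` dgm_elems A))
         (case_sum (\<lambda>a. point_dist (fst a) (fst (\<gamma> a)))
                   (\<lambda>b. point_dist (fst b) (diag_proj (fst b))))"
    by (rule injection_to_bijection[OF assms(5) \<gamma>]) (rule that)
  ultimately show ?thesis
    unfolding wasserstein_dist_less_iff[OF assms(1)] by (intro exI[of _ \<gamma>']) simp
qed

text \<open>The bijection \<open>\<beta>\<close> witnessing that \<open>A\<close> lies in the ball is kept fixed; composing it with a cheap bijection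
  from \<open>A\<close> to \<open>C\<close> perturbs its cost family by a family of small norm.\<close>

lemma wasserstein_ball_contains_ball:
  assumes "1 \<le> p" "wasserstein_dist p B A < ennreal r"
  obtains \<epsilon> where "0 < \<epsilon>"
    "\<And>C. wasserstein_dist p A C < ennreal \<epsilon> \<Longrightarrow> wasserstein_dist p B C < ennreal r"
proof -
  obtain \<beta> where \<beta>: "bij_betw \<beta> (dgm_elems B) (dgm_elems A)"
    and less: "ell_norm p (dgm_elems B) (\<lambda>b. point_dist (fst b) (fst (\<beta> b))) < ennreal r"
    using assms wasserstein_dist_less_iff[OF assms(1)] by blast
  obtain \<epsilon> where \<epsilon>: "0 < \<epsilon>" "\<And>e. ell_norm p (dgm_elems B) e < ennreal \<epsilon> \<Longrightarrow>
      ell_norm p (dgm_elems B) (\<lambda>b. point_dist (fst b) (fst (\<beta> b)) + e b) < ennreal r"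
    by (rule ell_norm_perturb[OF assms(1) less]) (rule that)
  have "wasserstein_dist p B C < ennreal r" if C: "wasserstein_dist p A C < ennreal \<epsilon>" for C
  proof -
    obtain \<gamma> where \<gamma>: "bij_betw \<gamma> (dgm_elems A) (dgm_elems C)"
      and less': "ell_norm p (dgm_elems A) (\<lambda>a. point_dist (fst a) (fst (\<gamma> a))) < ennreal \<epsilon>"
      using C wasserstein_dist_less_iff[OF assms(1)] by blast
    have "ell_norm p (dgm_elems B) (\<lambda>b. point_dist (fst (\<beta> b)) (fst (\<gamma> (\<beta> b)))) < ennreal \<epsilon>"
      using less' ell_norm_reindex[OF bij_betw_imp_inj_on[OF \<beta>]] bij_betw_imp_surj_on[OF \<beta>]
      by (simp add: o_def)
    from \<epsilon>(2)[OF this]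
    have "ell_norm p (dgm_elems B) (\<lambda>b. point_dist (fst b) (fst ((\<gamma> \<circ> \<beta>) b))) < ennreal r"
      by (rule le_less_trans[rotated]) (auto intro!: ell_norm_mono assms point_dist_triangle)
    then show ?thesis
      using wasserstein_dist_less_iff[OF assms(1)] bij_betw_trans[OF \<beta> \<gamma>] by blast
  qed
  then show ?thesis using that \<epsilon>(1) by blast
qed

section \<open>Removing the points at infinity\<close>

text \<open>
  The elements that survive the projection to \<open>\<D>\<^sub>F\<close>: those with finite coordinates, but also the
  copies of the diagonal point \<open>(\<infinity>, \<infinity>)\<close>, which belongs to every diagram.
\<close>

definition both_or_none_infinite :: "point \<Rightarrow> bool" where
  "both_or_none_infinite a \<longleftrightarrow> (fst a = \<infinity> \<longleftrightarrow> snd a = \<infinity>)"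

lemma dgm_elems_proj_finite:
  assumes "A \<in> diagrams"
  shows "dgm_elems (proj_finite A) = {a \<in> dgm_elems A. both_or_none_infinite (fst a)}"
proof -
  have "((x, y), k) \<in> dgm_elems (proj_finite A) \<longleftrightarrow>
      ((x, y), k) \<in> dgm_elems A \<and> both_or_none_infinite (x, y)" for x y k
  proof (cases "(x, y) \<in> diagonal")
    case True
    then show ?thesis by (auto simp: dgm_elems_def diagonal_def both_or_none_infinite_def)
  next
    case off: False
    show ?thesis
    proof (cases "(x, y) \<in># A")
      case True
      then have "x \<noteq> -\<infinity>" "x < y" using assms by (auto simp: diagrams_def)
      then have "(\<bar>x\<bar> \<noteq> \<infinity> \<and> \<bar>y\<bar> \<noteq> \<infinity>) \<longleftrightarrow> both_or_none_infinite (x, y)"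
        by (cases x; cases y) (auto simp: both_or_none_infinite_def)
      then show ?thesis using off by (auto simp: dgm_elems_def proj_finite_def)
    next
      case False
      then show ?thesis using off by (auto simp: dgm_elems_def proj_finite_def not_in_iff)
    qed
  qed
  then show ?thesis by auto
qed

text \<open>A bijection of finite cost moves every point by a finite distance, so it respects which coordinates are
  infinite and restricts to the surviving elements.\<close>

lemma wasserstein_dist_proj_finite:
  assumes "1 \<le> p" "A \<in> diagrams" "C \<in> diagrams" "wasserstein_dist p A C < ennreal r"
  shows "wasserstein_dist p (proj_finite A) (proj_finite C) < ennreal r"
proof -
  obtain \<gamma> where \<gamma>: "bij_betw \<gamma> (dgm_elems A) (dgm_elems C)"
    and less: "ell_norm p (dgm_elems A) (\<lambda>a. point_dist (fst a) (fst (\<gamma> a))) < ennreal r"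
    using assms wasserstein_dist_less_iff[OF assms(1)] by blast
  have "both_or_none_infinite (fst (\<gamma> a)) = both_or_none_infinite (fst a)"
    if "a \<in> dgm_elems A" for a
  proof -
    have "point_dist (fst a) (fst (\<gamma> a)) < ennreal r"
      using ell_norm_ge_element[OF assms(1) that, of "\<lambda>a. point_dist (fst a) (fst (\<gamma> a))"] less
      by simp
    then have "point_dist (fst a) (fst (\<gamma> a)) < top"
      by (metis less_le_trans top_greatest)
    then show ?thesis
      by (auto simp: point_dist_def both_or_none_infinite_def dest!: coord_dist_finite_imp)
  qed
  then have "bij_betw \<gamma> (dgm_elems (proj_finite A)) (dgm_elems (proj_finite C))"
    unfolding dgm_elems_proj_finite[OF assms(2)] dgm_elems_proj_finite[OF assms(3)]
      bij_betw_imp_surj_on[OF \<gamma>, symmetric]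
    by (intro bij_betw_subset[OF \<gamma>]) blast+
  moreover have "ell_norm p (dgm_elems (proj_finite A)) (\<lambda>a. point_dist (fst a) (fst (\<gamma> a))) < ennreal r"
    by (rule le_less_trans[OF ell_norm_mono[OF assms(1)] less])
      (auto simp: dgm_elems_proj_finite[OF assms(2)])
  ultimately show ?thesis using wasserstein_dist_less_iff[OF assms(1)] by blast
qed

section \<open>Continuity\<close>

lemma wasserstein_dist_self:
  assumes "1 \<le> p" "A \<in> diagrams"
  shows "wasserstein_dist p A A = 0"
proof -
  have "wasserstein_dist p A A < c" if "0 < c" for c
    unfolding wasserstein_dist_less_iff[OF assms(1)]
    using that by (intro exI[of _ id]) (simp add: ell_norm_zero[OF assms(1)] point_dist_self[OF assms(2)])
  then show ?thesis using less_irrefl zero_less_iff_neq_zero by blast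
qed

lemma wasserstein_div_self:
  assumes "1 \<le> p" "A \<in> diagrams"
  shows "wasserstein_div p f A A = 0"
proof -
  have "wasserstein_div p f A A < c" if "0 < c" for c
    unfolding wasserstein_div_less_iff[OF assms(1)]
  proof (rule bexI[of _ id])
    have "ell_norm p (dgm_elems A <+> (dgm_elems A - id ` dgm_elems A))
        (case_sum (\<lambda>a. point_dist (fst a) (fst (id a)))
          (\<lambda>b. f (point_dist (fst b) (diag_proj (fst b))))) = 0"
    proof (rule ell_norm_zero[OF assms(1)])
      fix s assume "s \<in> dgm_elems A <+> (dgm_elems A - id ` dgm_elems A)"
      then obtain a where "s = Inl a" "a \<in> dgm_elems A" by auto
      then show "case_sum (\<lambda>a. point_dist (fst a) (fst (id a)))
          (\<lambda>b. f (point_dist (fst b) (diag_proj (fst b)))) s = 0"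
        using point_dist_self[OF assms(2)] by simp
    qed
    then show "ell_norm p (dgm_elems A <+> (dgm_elems A - id ` dgm_elems A))
        (case_sum (\<lambda>a. point_dist (fst a) (fst (id a)))
          (\<lambda>b. f (point_dist (fst b) (diag_proj (fst b))))) < c"
      using that by simp
  qed (simp add: dgm_injections_def)
  then show ?thesis using less_irrefl zero_less_iff_neq_zero by blast
qed

lemma topspace_ball_topology:
  assumes "\<And>A. A \<in> S \<Longrightarrow> d A A = 0"
  shows "topspace (ball_topology S d) = S"
proof -
  have "A \<in> {C \<in> S. d A C < ennreal 1}" if "A \<in> S" for A
    using assms[OF that] that by simp
  then show ?thesis
    unfolding ball_topology_def topology_generated_by_topspace
    using zero_less_one by blast
qed

text \<open>Neighbourhoods suffice to recognise open sets because each member of \<open>S\<close> lies in the balls around itself.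
  The criterion covers divergences as well as distances.\<close>

lemma openin_ball_topology:
  assumes "\<And>A. A \<in> S \<Longrightarrow> d A A = 0" "U \<subseteq> S"
    and "\<And>A. A \<in> U \<Longrightarrow> \<exists>r>0. \<forall>C\<in>S. d A C < ennreal r \<longrightarrow> C \<in> U"
  shows "openin (ball_topology S d) U"
proof (subst openin_subopen, intro ballI)
  fix A assume "A \<in> U"
  then obtain r where r: "0 < r" "\<forall>C\<in>S. d A C < ennreal r \<longrightarrow> C \<in> U" using assms(3) by blast
  have "openin (ball_topology S d) {C \<in> S. d A C < ennreal r}"
    unfolding ball_topology_def
    using r \<open>A \<in> U\<close> assms(2) by (intro topology_generated_by_Basis) blast
  moreover have "A \<in> {C \<in> S. d A C < ennreal r}"
    using assms(1)[of A] \<open>A \<in> U\<close> assms(2) r by auto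
  ultimately show "\<exists>T. openin (ball_topology S d) T \<and> A \<in> T \<and> T \<subseteq> U"
    using r by (intro exI[of _ "{C \<in> S. d A C < ennreal r}"]) blast
qed

lemma continuous_map_ball_topology:
  assumes "\<And>A. A \<in> S \<Longrightarrow> d A A = 0" "\<And>A. A \<in> S' \<Longrightarrow> d' A A = 0"
    and "\<And>A. A \<in> S \<Longrightarrow> F A \<in> S'"
    and "\<And>A B r. \<lbrakk>A \<in> S; B \<in> S'; d' B (F A) < ennreal r\<rbrakk> \<Longrightarrow>
      \<exists>s>0. \<forall>C\<in>S. d A C < ennreal s \<longrightarrow> d' B (F C) < ennreal r"
  shows "continuous_map (ball_topology S d) (ball_topology S' d') F"
  unfolding ball_topology_def[of S']
proof (rule continuous_on_generated_topo)
  have cover: "\<Union> {{C \<in> S'. d' A C < ennreal r} |A r. A \<in> S' \<and> 0 < r} = S'"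
    using topspace_ball_topology[of S' d'] assms(2)
    unfolding ball_topology_def topology_generated_by_topspace by blast
  have top: "topspace (ball_topology S d) = S"
    by (rule topspace_ball_topology) (rule assms(1))
  show "F ` topspace (ball_topology S d) \<subseteq> \<Union> {{C \<in> S'. d' A C < ennreal r} |A r. A \<in> S' \<and> 0 < r}"
    unfolding cover top using assms(3) by (rule image_subsetI)
  fix U assume "U \<in> {{C \<in> S'. d' A C < ennreal r} |A r. A \<in> S' \<and> 0 < r}"
  then obtain B r where U: "U = {C \<in> S'. d' B C < ennreal r}" "B \<in> S'" by blast
  show "openin (ball_topology S d) (F -` U \<inter> topspace (ball_topology S d))"
    unfolding top
  proof (rule openin_ball_topology)
    fix A assume "A \<in> F -` U \<inter> S"
    then have "\<exists>s>0. \<forall>C\<in>S. d A C < ennreal s \<longrightarrow> d' B (F C) < ennreal r"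
      using U by (intro assms(4)) auto
    then show "\<exists>s>0. \<forall>C\<in>S. d A C < ennreal s \<longrightarrow> C \<in> F -` U \<inter> S"
      unfolding U(1) by (simp add: assms(3))
  qed (use assms(1) in auto)
qed

lemma continuous_map_first_topology_wasserstein:
  assumes "1 \<le> p" "subdiagonal_subadditive f" "strict_mono f" "p_increasing p f"
  shows "continuous_map (first_topology p f) (wasserstein_topology p diagrams) id"
  unfolding first_topology_def wasserstein_topology_def
proof (rule continuous_map_ball_topology)
  fix A B r assume "wasserstein_dist p B (id A) < ennreal r"
  then obtain \<epsilon> where \<epsilon>: "0 < \<epsilon>"
    "\<And>C. wasserstein_dist p A C < ennreal \<epsilon> \<Longrightarrow> wasserstein_dist p B C < ennreal r"
    using wasserstein_ball_contains_ball[OF assms(1)] by (metis id_apply)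
  \<comment> \<open>the divergence ball of radius \<open>f(c)\<close> around \<open>A\<close> lies in the distance ball of radius \<open>2c = \<epsilon>\<close>\<close>
  define c where "c = ennreal (\<epsilon> / 2)"
  have c: "0 < c" "2 * c = ennreal \<epsilon>"
    using \<epsilon>(1) ennreal_mult[of 2 "\<epsilon> / 2"] by (simp_all add: c_def)
  have fc: "0 < f c" "f c < top"
    using c(1) assms(2,3) by (auto simp: subdiagonal_subadditive_def strict_mono_def
        intro: le_less_trans[OF zero_le])
  then have "ennreal (enn2real (f c)) = f c" "0 < enn2real (f c)"
    by (auto simp: enn2real_positive_iff)
  then show "\<exists>s>0. \<forall>C\<in>diagrams. wasserstein_div p f A C < ennreal s \<longrightarrow>
      wasserstein_dist p B (id C) < ennreal r"
    using wasserstein_dist_less_of_div[OF assms, of _ A c] \<epsilon>(2) c(2)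
    by (intro exI[of _ "enn2real (f c)"]) auto
qed (auto simp: assms wasserstein_dist_self wasserstein_div_self)

lemma continuous_map_proj_finite:
  assumes "1 \<le> p"
  shows "continuous_map (wasserstein_topology p diagrams) (wasserstein_topology p finite_diagrams)
    proj_finite"
  unfolding wasserstein_topology_def
proof (rule continuous_map_ball_topology)
  fix A B r assume A: "A \<in> diagrams" and B: "wasserstein_dist p B (proj_finite A) < ennreal r"
  obtain \<epsilon> where "0 < \<epsilon>"
    "\<And>C. wasserstein_dist p (proj_finite A) C < ennreal \<epsilon> \<Longrightarrow> wasserstein_dist p B C < ennreal r"
    by (rule wasserstein_ball_contains_ball[OF assms B]) (rule that)
  then show "\<exists>s>0. \<forall>C\<in>diagrams. wasserstein_dist p A C < ennreal s \<longrightarrow>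
      wasserstein_dist p B (proj_finite C) < ennreal r"
    using wasserstein_dist_proj_finite[OF assms A] by blast
qed (auto simp: assms wasserstein_dist_self finite_diagrams_def diagrams_def proj_finite_def)

theorem theorem4p8:
  fixes p :: enat
    and f :: "ennreal \<Rightarrow> ennreal"
    and g :: "point multiset \<Rightarrow> 'x::real_normed_vector"
  assumes "1 \<le> p"
    and "subdiagonal_subadditive f"
    and "strict_mono f"
    and "p_increasing p f"
    and "continuous_map (wasserstein_topology p finite_diagrams) euclidean g"
  shows "continuous_map (first_topology p f) euclidean (g \<circ> (proj_finite \<circ> id))"
  by (intro continuous_map_compose[OF _ assms(5)]
      continuous_map_compose[OF continuous_map_first_topology_wasserstein[OF assms(1-4)]]
      continuous_map_proj_finite assms(1))

end
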